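(* Let $n=|I|\geq 3$, let $m_+\in B$, let $m_0=m_+>m_1>m_2>\cdots$ be the countable set $D_{m_+}$ with a total ordering compatible with the partial ordering $\leq$, and let $(s(m_r)(t))_{r\ge0}$ be the sequence produced by the $t$-algorithm. Put $\chi=\sum_{r\geq0}s(m_r)(t)\,m_r\in\mathcal{Y}_t^\infty$. Then $\chi\in\mathfrak{K}_t^\infty\cap\tilde D_{m_+}$. Moreover the only dominant monomial in $\chi$ is $m_0=m_+$.
   Context: Cartan data. $I=\{1,\dots,n\}$, $C=(C_{i,j})$ a Cartan matrix of finite type, $r_i\in\mathbb{N}^*$ with $(r_iC_{i,j})$ symmetric, coprime on each indecomposable component. $z$ is an indeterminate, $[l]_z=\frac{z^l-z^{-l}}{z-z^{-1}}$, $C(z)_{i,i}=z^{r_i}+z^{-r_i}$, $C(z)_{i,j}=[C_{i,j}]_z$ ($i\neq j$), $\tilde C(z)=C(z)^{-1}$; $(\tilde C_{i,j})_r\in\mathbb{Z}$ is the coefficient of $z^r$ in the expansion of $\tilde C_{i,j}(z)$ in $\mathbb{Z}((z^{-1}))$. Monomials. $\mathcal{Y}=\mathbb{Z}[Y_{i,l}^{\pm1}]_{i\in I,l\in\mathbb{Z}}$ (commutative), $A$ is its set of Laurent monomials $m=\prod Y_{i,l}^{u_{i,l}(m)}$, and $$A_{i,l}=Y_{i,l-r_i}Y_{i,l+r_i}\prod_{C_{j,i}=-1}Y_{j,l}^{-1}\prod_{C_{j,i}=-2}Y_{j,l+1}^{-1}Y_{j,l-1}^{-1}\prod_{C_{j,i}=-3}Y_{j,l+2}^{-1}Y_{j,l}^{-1}Y_{j,l-2}^{-1}.$$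 $m\le m'$ means that $m(m')^{-1}$ is a (possibly empty) product of elements $A_{i,l}^{-1}$. $B_i=\{m\in A:u_{i,l}(m)\ge0\ \forall l\}$, $B_J=\bigcap_{i\in J}B_i$ ($J$-dominant monomials), $B=B_I$ (dominant monomials). The algebra $\mathcal{Y}_t$. It is the free $\mathbb{Z}[t^{\pm1}]$-module with basis $\{:\!m\!:\,\mid m\in A\}$ and $\mathbb{Z}[t^{\pm1}]$-bilinear associative product $:\!m_1\!:\,:\!m_2\!:\,=t^{\mathcal{N}(m_1,m_2)}:\!m_1m_2\!:$, where $\mathcal{N}:A\times A\to\mathbb{Z}$ is the bicharacter with $\mathcal{N}(Y_{i,l},Y_{j,k})=(\tilde C_{j,i})_{r_j+l-k}-(\tilde C_{j,i})_{-r_j+l-k}$. Put $\tilde Y_{i,l}=:\!Y_{i,l}\!:$, $\tilde A_{i,l}=:\!A_{i,l}\!:$ (invertible, $\tilde A_{i,l}^{-1}=:\!A_{i,l}^{-1}\!:$). We identify $m$ with $:\!m\!:$; the monomials of an element are the $m$ with nonzero coefficient. $\overset{\rightarrow}{\prod}_{l}$ is the product ordered by increasing $l$. Completions. For $m\in B_i$ put $E_{i,t}(m)=\overset{\rightarrow}{\prod}_{l\in\mathbb{Z}}\bigl((\tilde Y_{i,l}(1+t\tilde A_{i,l+r_i}^{-1}))^{u_{i,l}(m)}\prod_{j\ne i}\tilde Y_{j,l}^{u_{j,l}(m)}\bigr)$. Let $\mathcal{Y}_t^{A,K}$ be the $\mathbb{Z}[t^{\pm1}]$-span of the $:\!a\!:$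 with $a$ a product of $K$ elements $A_{j,l}^{-1}$, $\mathcal{Y}_t^{A,\infty}=\prod_{K\ge0}\mathcal{Y}_t^{A,K}$, and $\mathcal{Y}_t^\infty=\sum_{M\in A}:\!M\!:\mathcal{Y}_t^{A,\infty}\subset\prod_{m\in A}\mathbb{Z}[t^{\pm1}]:\!m\!:$ (finite sums over $M$). $\mathfrak{K}_{i,t}^\infty\subset\mathcal{Y}_t^\infty$ is the set of finite sums, over $M\in A$, of elements $\sum_{K\ge0}\sum_a\lambda_a(t)E_{i,t}(Ma)$, where for each $K$ the inner sum is over finitely many products $a$ of $K$ elements $A_{j,l}^{-1}$ with $Ma\in B_i$, $\lambda_a(t)\in\mathbb{Z}[t^{\pm1}]$. $\mathfrak{K}_{J,t}^\infty=\bigcap_{i\in J}\mathfrak{K}_{i,t}^\infty$, $\mathfrak{K}_t^\infty=\mathfrak{K}_{I,t}^\infty$. The sets $D_m$. Let $\mathfrak{K}_i\subset\mathcal{Y}$ be the subring generated by the $Y_{i,l}(1+A_{i,l+r_i}^{-1})$ and $Y_{j,l}^{\pm1}$ ($j\neq i$, $l\in\mathbb{Z}$) and $\mathfrak{K}_J=\bigcap_{i\in J}\mathfrak{K}_i$. For $j\in J\subset I$ it is known (Frenkel–Reshetikhin, Frenkel–Mukhin) that there is a unique $E_J(Y_{j,l})\in\mathfrak{K}_J$ whose only $J$-dominant monomial is $Y_{j,l}$, with coefficient 1. For $m\in B_J$ put $E_J(m)=\prod_{i\notin J,l}Y_{i,l}^{u_{i,l}(m)}\prod_{j\in J,l}E_J(Y_{j,l})^{u_{j,l}(m)}$.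 For $m\in A$, $D_m$ is the set of $m'\in A$ for which there is a finite sequence $(m_0=m,m_1,\dots,m_R=m')$ such that for all $1\le r\le R$ there are $r'<r$ and $J\subset I$ with $m_{r'}\in B_J$ and, for all $r'<r''\le r$, $m_{r''}$ is a monomial of $E_J(m_{r'})$ and $m_{r''}m_{r''-1}^{-1}\in\{A_{j,l}^{-1}:l\in\mathbb{Z},j\in J\}$. $\tilde D_m\subset\mathcal{Y}_t^\infty$ is the submodule of all sums $\sum_{m'\in D_m}\lambda_{m'}(t):\!m'\!:$. The $F_{J,t}(m)$ and the $t$-algorithm. $J$ ranges over nonempty proper subsets of $I$. It is assumed known that for each such $J$ and each $m\in B_J$ there is a unique $F_{J,t}(m)\in\mathfrak{K}_{J,t}^\infty\cap\tilde D_m$ whose unique $J$-dominant monomial is $m$, with coefficient 1, and that the elements of $\mathfrak{K}_{J,t}^\infty\cap\tilde D_{m_+}$ are exactly the infinite sums $\sum_{m\in D_{m_+}\cap B_J}\lambda_m(t)F_{J,t}(m)$. For $m\in A\setminus B_J$ put $F_{J,t}(m)=0$. $[F_{J,t}(m_{r'})]_{m_r}\in\mathbb{Z}[t^{\pm1}]$ is the coefficient of $m_r$ in $F_{J,t}(m_{r'})$. The $t$-algorithm is the inductive definition of sequences $(s(m_r)(t))_{r\ge0}$, $(s_J(m_r)(t))_{r\ge0}$ in $\mathbb{Z}[t^{\pm1}]$ by: $s(m_0)(t)=1$, $s_J(m_0)(t)=0$, and for $r\ge1$: $s_J(m_r)(t)=\sum_{r'<r}(s(m_{r'})(t)-s_J(m_{r'})(t))[F_{J,t}(m_{r'})]_{m_r}$;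 $s(m_r)(t)=s_J(m_r)(t)$ if $m_r\notin B_J$; $s(m_r)(t)=0$ if $m_r\in B$. These formulas are consistent and determine the sequences uniquely (this may be assumed). *)

theory Defs
  imports
    "HOL-Analysis.Determinants"
    "HOL-Algebra.Generated_Rings"
    "HOL-Computational_Algebra.Formal_Laurent_Series"
    "HOL-Library.Poly_Mapping"
    "HOL-Library.Extended_Nat"
begin

text \<open>
  The index set \<open>I = {1, \<dots>, n}\<close> is a finite linearly ordered type \<open>'i\<close> with \<open>n = CARD('i)\<close>.
\<close>

section \<open>Cartan data\<close>

type_synonym 'i cmat = "int^'i^'i"

definition cartan_matrix :: "'i::finite cmat \<Rightarrow> bool" where
  "cartan_matrix C \<longleftrightarrow>
     (\<forall>i. C $ i $ i = 2) \<and>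
     (\<forall>i j. i \<noteq> j \<longrightarrow> C $ i $ j \<le> 0) \<and>
     (\<forall>i j. C $ i $ j = 0 \<longleftrightarrow> C $ j $ i = 0)"

definition principal_minor :: "'i::finite cmat \<Rightarrow> 'i set \<Rightarrow> int" where
  "principal_minor C S = (\<Sum>p | p permutes S. sign p * (\<Prod>i\<in>S. C $ i $ p i))"

definition finite_type :: "'i::finite cmat \<Rightarrow> bool" where
  "finite_type C \<longleftrightarrow> cartan_matrix C \<and> (\<forall>S. principal_minor C S > 0)"

definition component :: "'i::finite cmat \<Rightarrow> 'i \<Rightarrow> 'i set" where
  "component C i = {j. (i, j) \<in> {(a, b). C $ a $ b \<noteq> 0}\<^sup>*}"

definition cartan_data :: "'i::finite cmat \<Rightarrow> ('i \<Rightarrow> nat) \<Rightarrow> bool" where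
  "cartan_data C r \<longleftrightarrow> finite_type C \<and>
     (\<forall>i. r i > 0) \<and>
     (\<forall>i j. int (r i) * C $ i $ j = int (r j) * C $ j $ i) \<and>
     (\<forall>i. Gcd (r ` component C i) = 1)"

text \<open>
  \<open>\<int>((z\<^sup>-\<^sup>1))\<close> is embedded in the field of formal Laurent series over \<open>\<rat>\<close> whose formal variable
  \<open>fls_X\<close> is \<open>z\<^sup>-\<^sup>1\<close>; hence the coefficient of \<open>z\<^sup>k\<close> is the one with index \<open>-k\<close>.
\<close>

abbreviation zvar :: "rat fls" where
  "zvar \<equiv> inverse fls_X"

definition qint :: "int \<Rightarrow> rat fls" where
  "qint l = (zvar powi l - zvar powi (- l)) / (zvar - inverse zvar)"

definition Cz :: "'i::finite cmat \<Rightarrow> ('i \<Rightarrow> nat) \<Rightarrow> rat fls^'i^'i" where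
  "Cz C r = (\<chi> i j. if i = j then zvar powi int (r i) + zvar powi (- int (r i))
                    else qint (C $ i $ j))"

text \<open>The coefficients of the inverse are integers; the floor only changes the type.\<close>

definition Ctilde :: "'i::finite cmat \<Rightarrow> ('i \<Rightarrow> nat) \<Rightarrow> 'i \<Rightarrow> 'i \<Rightarrow> int \<Rightarrow> int" where
  "Ctilde C r i j k = \<lfloor>fls_nth (matrix_inv (Cz C r) $ i $ j) (- k)\<rfloor>"


section \<open>Monomials\<close>

text \<open>
  A Laurent monomial \<open>m\<close> is the finitely supported family of its exponents \<open>u\<^sub>i\<^sub>,\<^sub>l(m)\<close>, so that
  the group of monomials is written additively: \<open>m + m'\<close> stands for the product \<open>m m'\<close>, \<open>- m\<close>
  for \<open>m\<^sup>-\<^sup>1\<close> and \<open>0\<close> for the monomial \<open>1\<close>.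
\<close>

type_synonym 'i mon = "('i \<times> int) \<Rightarrow>\<^sub>0 int"

abbreviation expo :: "'i mon \<Rightarrow> 'i \<Rightarrow> int \<Rightarrow> int" where
  "expo m i l \<equiv> Poly_Mapping.lookup m (i, l)"

definition Yv :: "'i \<Rightarrow> int \<Rightarrow> 'i mon" where
  "Yv i l = Poly_Mapping.single (i, l) 1"

definition Av :: "'i::finite cmat \<Rightarrow> ('i \<Rightarrow> nat) \<Rightarrow> 'i \<Rightarrow> int \<Rightarrow> 'i mon" where
  "Av C r i l =
     Yv i (l - int (r i)) + Yv i (l + int (r i))
     - (\<Sum>j | C $ j $ i = -1. Yv j l)
     - (\<Sum>j | C $ j $ i = -2. Yv j (l + 1) + Yv j (l - 1))
     - (\<Sum>j | C $ j $ i = -3. Yv j (l + 2) + Yv j l + Yv j (l - 2))"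

definition Ainv_prods :: "'i::finite cmat \<Rightarrow> ('i \<Rightarrow> nat) \<Rightarrow> nat \<Rightarrow> 'i mon set" where
  "Ainv_prods C r K = {(\<Sum>(i, l)\<leftarrow>ps. - Av C r i l) | ps. length ps = K}"

definition mon_le :: "'i::finite cmat \<Rightarrow> ('i \<Rightarrow> nat) \<Rightarrow> 'i mon \<Rightarrow> 'i mon \<Rightarrow> bool" where
  "mon_le C r m m' \<longleftrightarrow> (\<exists>K. m - m' \<in> Ainv_prods C r K)"

definition dominant :: "'i set \<Rightarrow> 'i mon set" where
  "dominant J = {m. \<forall>i\<in>J. \<forall>l. expo m i l \<ge> 0}"


section \<open>The algebra \<open>\<Y>\<^sub>t\<close>\<close>

text \<open>Laurent polynomials over \<open>\<int>\<close> in \<open>t\<close>, as the group ring of \<open>\<int>\<close>.\<close>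

type_synonym lpoly = "int \<Rightarrow>\<^sub>0 int"

definition tpow :: "int \<Rightarrow> lpoly" where
  "tpow k = Poly_Mapping.single k 1"

definition Npair :: "'i::finite cmat \<Rightarrow> ('i \<Rightarrow> nat) \<Rightarrow> 'i \<times> int \<Rightarrow> 'i \<times> int \<Rightarrow> int" where
  "Npair C r p q = (case p of (i, l) \<Rightarrow> case q of (j, k) \<Rightarrow>
     Ctilde C r j i (int (r j) + l - k) - Ctilde C r j i (- int (r j) + l - k))"

definition Nform :: "'i::finite cmat \<Rightarrow> ('i \<Rightarrow> nat) \<Rightarrow> 'i mon \<Rightarrow> 'i mon \<Rightarrow> int" where
  "Nform C r m m' =
     (\<Sum>p\<in>Poly_Mapping.keys m. \<Sum>q\<in>Poly_Mapping.keys m'.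
        Poly_Mapping.lookup m p * Poly_Mapping.lookup m' q * Npair C r p q)"

text \<open>
  Elements of the free module on the \<open>:m:\<close>. Its pointwise addition is the addition of \<open>\<Y>\<^sub>t\<close>,
  but the type-class multiplication of \<open>yt\<close> is not that of \<open>\<Y>\<^sub>t\<close>, which is \<open>yt_mult\<close>.
\<close>

type_synonym 'i yt = "'i mon \<Rightarrow>\<^sub>0 lpoly"

definition yt_mult :: "'i::finite cmat \<Rightarrow> ('i \<Rightarrow> nat) \<Rightarrow> 'i yt \<Rightarrow> 'i yt \<Rightarrow> 'i yt" where
  "yt_mult C r x y =
     (\<Sum>m\<in>Poly_Mapping.keys x. \<Sum>m'\<in>Poly_Mapping.keys y.
        Poly_Mapping.single (m + m')
          (Poly_Mapping.lookup x m * Poly_Mapping.lookup y m' * tpow (Nform C r m m')))"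

definition Yt :: "'i::finite cmat \<Rightarrow> ('i \<Rightarrow> nat) \<Rightarrow> 'i yt ring" where
  "Yt C r = \<lparr>carrier = UNIV, mult = yt_mult C r, one = Poly_Mapping.single 0 1,
             zero = 0, add = (+)\<rparr>"

definition bas :: "'i mon \<Rightarrow> 'i yt" where
  "bas m = Poly_Mapping.single m 1"

definition ordered_prod :: "('a, 'b) monoid_scheme \<Rightarrow> ('c \<Rightarrow> 'a) \<Rightarrow> 'c::linorder set \<Rightarrow> 'a" where
  "ordered_prod G f S =
     foldr (\<lambda>x y. x \<otimes>\<^bsub>G\<^esub> y) (map f (sorted_list_of_set S)) \<one>\<^bsub>G\<^esub>"

text \<open>
  The product over \<open>l\<close> is restricted to the finitely many \<open>l\<close> that occur in \<open>m\<close>, the other factors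
  being \<open>1\<close>. The factors \<open>Y\<^sub>j\<^sub>,\<^sub>l\<close> with the same \<open>l\<close> commute with each other, so their order
  is immaterial. Negative powers are powers of the inverse in \<open>\<Y>\<^sub>t\<close>; the inverse of
  \<open>:Y\<^sub>j\<^sub>,\<^sub>l:\<close> is a power of \<open>t\<close> times \<open>:Y\<^sub>j\<^sub>,\<^sub>l\<^sup>-\<^sup>1:\<close>.
\<close>

definition E_it ::
  "'i::{finite,linorder} cmat \<Rightarrow> ('i \<Rightarrow> nat) \<Rightarrow> 'i \<Rightarrow> 'i mon \<Rightarrow> 'i yt" where
  "E_it C r i m =
     ordered_prod (Yt C r)
       (\<lambda>l. ((bas (Yv i l) \<otimes>\<^bsub>Yt C r\<^esub>
               (\<one>\<^bsub>Yt C r\<^esub> \<oplus>\<^bsub>Yt C r\<^esub> Poly_Mapping.single (- Av C r i (l + int (r i))) (tpow 1)))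
              [^]\<^bsub>Yt C r\<^esub> expo m i l)
            \<otimes>\<^bsub>Yt C r\<^esub>
            ordered_prod (Yt C r) (\<lambda>j. bas (Yv j l) [^]\<^bsub>Yt C r\<^esub> expo m j l) (UNIV - {i}))
       {l. \<exists>j. expo m j l \<noteq> 0}"


section \<open>Completions\<close>

text \<open>Elements of \<open>\<Prod>\<^sub>m \<int>[t\<^sup>\<plusminus>\<^sup>1] :m:\<close>.\<close>

type_synonym 'i yt_full = "'i mon \<Rightarrow> lpoly"

definition supp :: "'i yt_full \<Rightarrow> 'i mon set" where
  "supp x = {m. x m \<noteq> 0}"

text \<open>
  \<open>x\<close> is the sum of the possibly infinite family \<open>(f k)\<^bsub>k \<in> S\<^esub>\<close>: in each coefficient only finitely
  many members contribute.
\<close>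

definition has_formal_sum :: "('k \<Rightarrow> 'i yt_full) \<Rightarrow> 'k set \<Rightarrow> 'i yt_full \<Rightarrow> bool" where
  "has_formal_sum f S x \<longleftrightarrow>
     (\<forall>m. finite {k\<in>S. f k m \<noteq> 0} \<and> x m = (\<Sum>k | k \<in> S \<and> f k m \<noteq> 0. f k m))"

definition YtA :: "'i::finite cmat \<Rightarrow> ('i \<Rightarrow> nat) \<Rightarrow> nat \<Rightarrow> 'i yt set" where
  "YtA C r K = {x. Poly_Mapping.keys x \<subseteq> Ainv_prods C r K}"

definition YtA_inf :: "'i::finite cmat \<Rightarrow> ('i \<Rightarrow> nat) \<Rightarrow> 'i yt_full set" where
  "YtA_inf C r = {x. \<exists>y. (\<forall>K. y K \<in> YtA C r K) \<and>
                         has_formal_sum (\<lambda>K. Poly_Mapping.lookup (y K)) UNIV x}"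

text \<open>The left multiplication by \<open>:M:\<close>, i.e. \<open>\<Sum>\<^sub>a \<lambda>\<^sub>a :a: \<mapsto> \<Sum>\<^sub>a \<lambda>\<^sub>a t\<^bsup>N(M,a)\<^esup> :M a:\<close>.\<close>

definition lmult :: "'i::finite cmat \<Rightarrow> ('i \<Rightarrow> nat) \<Rightarrow> 'i mon \<Rightarrow> 'i yt_full \<Rightarrow> 'i yt_full" where
  "lmult C r M x = (\<lambda>m. tpow (Nform C r M (m - M)) * x (m - M))"

definition Yt_inf :: "'i::finite cmat \<Rightarrow> ('i \<Rightarrow> nat) \<Rightarrow> 'i yt_full set" where
  "Yt_inf C r = {x. \<exists>S y. finite S \<and> (\<forall>M\<in>S. y M \<in> YtA_inf C r) \<and>
                          x = (\<lambda>m. \<Sum>M\<in>S. lmult C r M (y M) m)}"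

definition K_it_part ::
  "'i::{finite,linorder} cmat \<Rightarrow> ('i \<Rightarrow> nat) \<Rightarrow> 'i \<Rightarrow> 'i mon \<Rightarrow> 'i yt_full set" where
  "K_it_part C r i M =
     {x. \<exists>T lam. (\<forall>K. finite (T K) \<and> T K \<subseteq> {a \<in> Ainv_prods C r K. M + a \<in> dominant {i}}) \<and>
           has_formal_sum
             (\<lambda>K m. \<Sum>a\<in>T K. lam a * Poly_Mapping.lookup (E_it C r i (M + a)) m) UNIV x}"

definition K_it ::
  "'i::{finite,linorder} cmat \<Rightarrow> ('i \<Rightarrow> nat) \<Rightarrow> 'i \<Rightarrow> 'i yt_full set" where
  "K_it C r i = {x \<in> Yt_inf C r. \<exists>S y. finite S \<and> (\<forall>M\<in>S. y M \<in> K_it_part C r i M) \<and>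
                                       x = (\<lambda>m. \<Sum>M\<in>S. y M m)}"

definition K_Jt ::
  "'i::{finite,linorder} cmat \<Rightarrow> ('i \<Rightarrow> nat) \<Rightarrow> 'i set \<Rightarrow> 'i yt_full set" where
  "K_Jt C r J = (\<Inter>i\<in>J. K_it C r i)"


section \<open>The sets \<open>D\<^sub>m\<close>\<close>

type_synonym 'i yring = "'i mon \<Rightarrow>\<^sub>0 int"

definition Yring :: "'i yring ring" where
  "Yring = \<lparr>carrier = UNIV, mult = (*), one = 1, zero = 0, add = (+)\<rparr>"

abbreviation ymon :: "'i mon \<Rightarrow> 'i yring" where
  "ymon m \<equiv> Poly_Mapping.single m 1"

definition K_i :: "'i::finite cmat \<Rightarrow> ('i \<Rightarrow> nat) \<Rightarrow> 'i \<Rightarrow> 'i yring set" where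
  "K_i C r i = generate_ring Yring
     ({ymon (Yv i l) * (1 + ymon (- Av C r i (l + int (r i)))) | l. True}
      \<union> {ymon (Yv j l) | j l. j \<noteq> i} \<union> {ymon (- Yv j l) | j l. j \<noteq> i})"

definition K_J :: "'i::finite cmat \<Rightarrow> ('i \<Rightarrow> nat) \<Rightarrow> 'i set \<Rightarrow> 'i yring set" where
  "K_J C r J = (\<Inter>i\<in>J. K_i C r i)"

definition E_Y :: "'i::finite cmat \<Rightarrow> ('i \<Rightarrow> nat) \<Rightarrow> 'i set \<Rightarrow> 'i \<Rightarrow> int \<Rightarrow> 'i yring" where
  "E_Y C r J j l = (THE x. x \<in> K_J C r J \<and>
     Poly_Mapping.keys x \<inter> dominant J = {Yv j l} \<and> Poly_Mapping.lookup x (Yv j l) = 1)"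

text \<open>Only used for \<open>m \<in> dominant J\<close>, so that \<open>nat\<close> does not truncate.\<close>

definition E_J :: "'i::finite cmat \<Rightarrow> ('i \<Rightarrow> nat) \<Rightarrow> 'i set \<Rightarrow> 'i mon \<Rightarrow> 'i yring" where
  "E_J C r J m =
     (\<Prod>(i, l) \<in> {(i, l). i \<notin> J \<and> expo m i l \<noteq> 0}. ymon (Poly_Mapping.single (i, l) (expo m i l)))
     * (\<Prod>(j, l) \<in> {(j, l). j \<in> J \<and> expo m j l \<noteq> 0}. E_Y C r J j l ^ nat (expo m j l))"

definition Dset :: "'i::finite cmat \<Rightarrow> ('i \<Rightarrow> nat) \<Rightarrow> 'i mon \<Rightarrow> 'i mon set" where
  "Dset C r m = {m'. \<exists>(R::nat) f. f 0 = m \<and> f R = m' \<and>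
     (\<forall>p. 1 \<le> p \<and> p \<le> R \<longrightarrow>
        (\<exists>p' J. p' < p \<and> f p' \<in> dominant J \<and>
           (\<forall>p''. p' < p'' \<and> p'' \<le> p \<longrightarrow>
              f p'' \<in> Poly_Mapping.keys (E_J C r J (f p')) \<and>
              f p'' - f (p'' - 1) \<in> {- Av C r j l | j l. j \<in> J})))}"

definition Dtilde :: "'i::finite cmat \<Rightarrow> ('i \<Rightarrow> nat) \<Rightarrow> 'i mon \<Rightarrow> 'i yt_full set" where
  "Dtilde C r m = {x \<in> Yt_inf C r. supp x \<subseteq> Dset C r m}"


section \<open>The \<open>F\<^bsub>J,t\<^esub>(m)\<close> and the \<open>t\<close>-algorithm\<close>

definition is_F :: "'i::{finite,linorder} cmat \<Rightarrow> ('i \<Rightarrow> nat) \<Rightarrow> 'i set \<Rightarrow> 'i mon \<Rightarrow>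
    'i yt_full \<Rightarrow> bool" where
  "is_F C r J m x \<longleftrightarrow> x \<in> K_Jt C r J \<inter> Dtilde C r m \<and> supp x \<inter> dominant J = {m} \<and> x m = 1"

definition F_Jt :: "'i::{finite,linorder} cmat \<Rightarrow> ('i \<Rightarrow> nat) \<Rightarrow> 'i set \<Rightarrow> 'i mon \<Rightarrow>
    'i yt_full" where
  "F_Jt C r J m = (if m \<in> dominant J then (THE x. is_F C r J m x) else (\<lambda>_. 0))"

text \<open>
  \<open>ms\<close> enumerates \<open>D\<^bsub>m+\<^esub>\<close>, with index set \<open>{q. enat q < N}\<close> since \<open>D\<^bsub>m+\<^esub>\<close> may be finite;
  smaller monomials come later.
\<close>

definition D_enumeration ::
  "'i::finite cmat \<Rightarrow> ('i \<Rightarrow> nat) \<Rightarrow> 'i mon \<Rightarrow> enat \<Rightarrow> (nat \<Rightarrow> 'i mon) \<Rightarrow> bool" where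
  "D_enumeration C r mp N ms \<longleftrightarrow>
     bij_betw ms {q. enat q < N} (Dset C r mp) \<and> ms 0 = mp \<and>
     (\<forall>p q. enat p < N \<and> enat q < N \<and> mon_le C r (ms p) (ms q) \<longrightarrow> q \<le> p)"

definition t_algorithm :: "'i::{finite,linorder} cmat \<Rightarrow> ('i \<Rightarrow> nat) \<Rightarrow> enat \<Rightarrow> (nat \<Rightarrow> 'i mon) \<Rightarrow>
    (nat \<Rightarrow> lpoly) \<Rightarrow> ('i set \<Rightarrow> nat \<Rightarrow> lpoly) \<Rightarrow> bool" where
  "t_algorithm C r N ms s sJ \<longleftrightarrow>
     s 0 = 1 \<and>
     (\<forall>J. J \<noteq> {} \<and> J \<noteq> UNIV \<longrightarrow> sJ J 0 = 0) \<and>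
     (\<forall>q\<ge>1. enat q < N \<longrightarrow>
        (\<forall>J. J \<noteq> {} \<and> J \<noteq> UNIV \<longrightarrow>
           sJ J q = (\<Sum>p<q. (s p - sJ J p) * F_Jt C r J (ms p) (ms q)) \<and>
           (ms q \<notin> dominant J \<longrightarrow> s q = sJ J q)) \<and>
        (ms q \<in> dominant UNIV \<longrightarrow> s q = 0))"

end

theory Submission
  imports Defs
begin

text \<open>
  For \<open>J = {i}\<close>, put \<open>\<lambda>\<^sub>p = s(m\<^sub>p) - s\<^sub>J(m\<^sub>p)\<close>. The recursion of the \<open>t\<close>-algorithm says exactly that the
  coefficient of \<open>m\<^sub>q\<close> in \<open>\<Sum>\<^sub>p \<lambda>\<^sub>p F\<^bsub>J,t\<^esub>(m\<^sub>p)\<close> is \<open>s(m\<^sub>q)\<close>: the terms with \<open>p < q\<close> give \<open>s\<^sub>J(m\<^sub>q)\<close>, the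
  term \<open>p = q\<close> gives \<open>s(m\<^sub>q) - s\<^sub>J(m\<^sub>q)\<close>, whether \<open>m\<^sub>q\<close> is \<open>J\<close>-dominant or not, and the terms with
  \<open>p > q\<close> vanish because the monomials of \<open>F\<^bsub>J,t\<^esub>(m)\<close> lie in \<open>D\<^sub>m\<close> and hence below \<open>m\<close>. So \<open>\<chi>\<close> is such
  a sum for every \<open>i\<close>.
\<close>

text \<open>The condition inside \<open>Dset\<close>, with the length and the sequence made explicit
  so that paths can be concatenated and cut into steps.\<close>

definition D_path ::
  "'i::finite cmat \<Rightarrow> ('i \<Rightarrow> nat) \<Rightarrow> nat \<Rightarrow> (nat \<Rightarrow> 'i mon) \<Rightarrow> bool" where
  "D_path C r R f \<longleftrightarrow> (\<forall>p. 1 \<le> p \<and> p \<le> R \<longrightarrow>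
     (\<exists>p' J. p' < p \<and> f p' \<in> dominant J \<and>
        (\<forall>p''. p' < p'' \<and> p'' \<le> p \<longrightarrow>
           f p'' \<in> Poly_Mapping.keys (E_J C r J (f p')) \<and>
           f p'' - f (p'' - 1) \<in> {- Av C r j l | j l. j \<in> J})))"

lemma Dset_iff_D_path: "m' \<in> Dset C r m \<longleftrightarrow> (\<exists>R f. f 0 = m \<and> f R = m' \<and> D_path C r R f)"
  unfolding Dset_def D_path_def by blast

lemma Dset_refl: "m \<in> Dset C r m"
  unfolding Dset_iff_D_path by (rule exI[of _ 0], rule exI[of _ "\<lambda>_. m"]) (simp add: D_path_def)

lemma D_path_step:
  assumes "D_path C r R f" "p < R"
  obtains j l where "f (Suc p) - f p = - Av C r j l"
proof -
  have "1 \<le> Suc p \<and> Suc p \<le> R" using assms(2) by simp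
  with assms(1) obtain p' J where "p' < Suc p"
    and *: "\<forall>p''. p' < p'' \<and> p'' \<le> Suc p \<longrightarrow>
      f p'' \<in> Poly_Mapping.keys (E_J C r J (f p')) \<and>
      f p'' - f (p'' - 1) \<in> {- Av C r j l | j l. j \<in> J}"
    unfolding D_path_def by meson
  with *[rule_format, of "Suc p"] that show thesis by auto
qed

text \<open>The condition at a position looks back only as far as its own \<open>p'\<close>. So the
  witnesses for \<open>f\<close> stay valid, and those for \<open>g\<close> are shifted by
  \<open>R\<close> without reaching into \<open>f\<close>.\<close>

lemma D_path_append:
  assumes f: "D_path C r R f" and g: "D_path C r R' g" and fg: "f R = g 0"
  shows "D_path C r (R + R') (\<lambda>p. if p \<le> R then f p else g (p - R))"
    (is "D_path C r _ ?h")
  unfolding D_path_def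
proof (intro allI impI)
  fix p assume p: "1 \<le> p \<and> p \<le> R + R'"
  let ?good = "\<lambda>h J p' p''. h p'' \<in> Poly_Mapping.keys (E_J C r J (h p')) \<and>
      h p'' - h (p'' - 1) \<in> {- Av C r j l | j l. j \<in> J}"
  show "\<exists>p' J. p' < p \<and> ?h p' \<in> dominant J \<and>
      (\<forall>p''. p' < p'' \<and> p'' \<le> p \<longrightarrow> ?good ?h J p' p'')"
  proof (cases "p \<le> R")
    case True
    with p f obtain p' J where "p' < p" "f p' \<in> dominant J"
      "\<forall>p''. p' < p'' \<and> p'' \<le> p \<longrightarrow> ?good f J p' p''"
      unfolding D_path_def by meson
    with True show ?thesis by (intro exI[of _ p'] exI[of _ J]) auto
  next
    case False
    \<comment> \<open>For \<open>k = 0\<close> the value comes from \<open>f\<close>, and the gluing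
      condition \<open>fg\<close> is needed.\<close>
    have h: "?h (R + k) = g k" for k using fg by auto
    have "1 \<le> p - R \<and> p - R \<le> R'" using False p by auto
    with g obtain p' J where p': "p' < p - R" and dom: "g p' \<in> dominant J"
      and *: "\<forall>p''. p' < p'' \<and> p'' \<le> p - R \<longrightarrow> ?good g J p' p''"
      unfolding D_path_def by meson
    have "?good ?h J (R + p') p''" if "R + p' < p'' \<and> p'' \<le> p" for p''
    proof -
      \<comment> \<open>Writing \<open>p''\<close> as \<open>R + Suc k\<close> turns
        \<open>p'' - 1\<close> into \<open>R + k\<close>, so both values are read off from
        \<open>g\<close>, even at the junction.\<close>
      obtain k where k: "p'' = R + Suc k" "p' < Suc k" "Suc k \<le> p - R"
        using \<open>R + p' < p'' \<and> p'' \<le> p\<close> by (intro that[of "p'' - R - 1"]) auto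
      have k1: "p'' - 1 = R + k" using k(1) by simp
      show ?thesis
        using *[rule_format, of "Suc k"] k(2,3) unfolding k1 unfolding k(1) h by simp
    qed
    then show ?thesis
      using p' dom h[of p'] by (intro exI[of _ "R + p'"] exI[of _ J]) (simp only: h, simp)
  qed
qed

text \<open>Used to see that the monomials of \<open>F_Jt C r J m\<close> stay in the set of
  \<open>mp\<close> when \<open>m\<close> lies there.\<close>

lemma Dset_trans:
  assumes "m' \<in> Dset C r m" "m'' \<in> Dset C r m'"
  shows "m'' \<in> Dset C r m"
proof -
  obtain R f where f: "f 0 = m" "f R = m'" "D_path C r R f"
    using assms(1) by (auto simp: Dset_iff_D_path)
  obtain R' g where g: "g 0 = m'" "g R' = m''" "D_path C r R' g"
    using assms(2) by (auto simp: Dset_iff_D_path)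
  show ?thesis
    unfolding Dset_iff_D_path using D_path_append[OF f(3) g(3)] f g
    by (intro exI[of _ "R + R'"] exI[of _ "\<lambda>p. if p \<le> R then f p else g (p - R)"]) auto
qed

text \<open>Every step of a path contributes exactly one inverse \<open>Av\<close>, so the number of
  factors is the number of steps.\<close>

lemma Dset_mon_le:
  assumes "m' \<in> Dset C r m"
  shows "mon_le C r m' m"
proof -
  obtain R f where f: "f 0 = m" "f R = m'" "D_path C r R f"
    using assms by (auto simp: Dset_iff_D_path)
  have "f k - f 0 \<in> Ainv_prods C r k" if "k \<le> R" for k
    using that
  proof (induction k)
    case 0
    show ?case by (simp add: Ainv_prods_def)
  next
    case (Suc k)
    then obtain ps where ps: "f k - f 0 = (\<Sum>(i, l)\<leftarrow>ps. - Av C r i l)" "length ps = k"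
      by (auto simp: Ainv_prods_def)
    obtain j l where jl: "f (Suc k) - f k = - Av C r j l"
      using D_path_step[OF f(3)] Suc.prems by (meson Suc_le_lessD)
    have "f (Suc k) - f 0 = (f (Suc k) - f k) + (f k - f 0)" by simp
    also have "\<dots> = (\<Sum>(i, l)\<leftarrow>(j, l) # ps. - Av C r i l)" by (simp add: ps jl)
    finally show ?case
      using ps(2) unfolding Ainv_prods_def by (intro CollectI exI[of _ "(j, l) # ps"]) simp
  qed
  from this[of R] f show ?thesis by (auto simp: mon_le_def)
qed

lemma is_F_F_Jt:
  assumes "m \<in> dominant J" "\<exists>!x. is_F C r J m x"
  shows "is_F C r J m (F_Jt C r J m)"
  using theI'[OF assms(2)] assms(1) by (simp add: F_Jt_def)

theorem lemma5p25:
  fixes C :: "'i::{finite,linorder} cmat"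
    and r :: "'i \<Rightarrow> nat"
    and mp :: "'i mon"
    and N :: enat
    and ms :: "nat \<Rightarrow> 'i mon"
    and s :: "nat \<Rightarrow> lpoly"
    and sJ :: "'i set \<Rightarrow> nat \<Rightarrow> lpoly"
    and chi :: "'i yt_full"
  assumes "cartan_data C r"
    and "CARD('i) \<ge> 3"
    and "\<And>J m. J \<noteq> {} \<Longrightarrow> J \<noteq> UNIV \<Longrightarrow> m \<in> dominant J \<Longrightarrow> \<exists>!x. is_F C r J m x"
    and "mp \<in> dominant UNIV"
    and "\<And>J. J \<noteq> {} \<Longrightarrow> J \<noteq> UNIV \<Longrightarrow>
           K_Jt C r J \<inter> Dtilde C r mp =
           {x. \<exists>lam :: 'i mon \<Rightarrow> lpoly.
                 has_formal_sum (\<lambda>m m'. lam m * F_Jt C r J m m') (Dset C r mp \<inter> dominant J) x}"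
    and "D_enumeration C r mp N ms"
    and "t_algorithm C r N ms s sJ"
    and "chi = (\<lambda>m. \<Sum>q | enat q < N \<and> ms q = m. s q)"
  shows "chi \<in> K_Jt C r UNIV \<inter> Dtilde C r mp \<and> supp chi \<inter> dominant UNIV = {mp}"
proof -
  let ?I = "{q. enat q < N}" and ?D = "Dset C r mp"
  note bij = assms(6)[unfolded D_enumeration_def, THEN conjunct1]
  have ms0: "ms 0 = mp" using assms(6) by (simp add: D_enumeration_def)
  have ms_le: "q \<le> p" if "p \<in> ?I" "q \<in> ?I" "mon_le C r (ms p) (ms q)" for p q
    using assms(6) that by (auto simp: D_enumeration_def)
  have inj: "inj_on ms ?I" and img: "ms ` ?I = ?D"
    using bij by (auto simp: bij_betw_def)
  \<comment> \<open>The bound \<open>N\<close> is positive because the enumerated set contains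
    \<open>mp\<close>.\<close>
  have zero: "0 \<in> ?I"
  proof -
    obtain q where "enat q < N" using Dset_refl[of mp C r] img by blast
    then show ?thesis by (metis le_less_trans mem_Collect_eq zero_enat_def zero_le)
  qed
  have chi_ms: "chi (ms q) = s q" if "q \<in> ?I" for q
  proof -
    have "{p. enat p < N \<and> ms p = ms q} = {q}" using that inj by (auto dest: inj_onD)
    then show ?thesis by (simp add: assms(8))
  qed
  have chi_out: "chi m = 0" if "m \<notin> ?D" for m
  proof -
    have "{p. enat p < N \<and> ms p = m} = {}" using that img by auto
    then show ?thesis by (simp add: assms(8) del: Collect_empty_eq)
  qed
  have chi_sum: "chi \<in> K_Jt C r J \<inter> Dtilde C r mp" if J: "J \<noteq> {}" "J \<noteq> UNIV" for J
  proof -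
    define F where "F = F_Jt C r J"
    \<comment> \<open>The coefficients are indexed by monomials in the expansion but by positions in
      the algorithm; the inverse enumeration translates.\<close>
    define lam where "lam m = (let p = the_inv_into ?I ms m in s p - sJ J p)" for m
    have lam: "lam (ms p) = s p - sJ J p" if "p \<in> ?I" for p
      using the_inv_into_f_f[OF inj that] by (simp add: lam_def)
    have F_nondom: "F m m' = 0" if "m \<notin> dominant J" for m m'
      using that by (simp add: F_def F_Jt_def)
    have is_F: "is_F C r J m (F m)" if "m \<in> dominant J" for m
      using is_F_F_Jt[OF that assms(3)[OF J that]] by (simp add: F_def)
    have F_D: "m' \<in> Dset C r m" if "F m m' \<noteq> 0" for m m'
    proof -
      have "m \<in> dominant J" using that F_nondom by blast
      then show ?thesis using is_F[of m] that by (auto simp: is_F_def Dtilde_def supp_def)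
    qed
    have F_self: "F m m = 1" if "m \<in> dominant J" for m
      using is_F[OF that] by (simp add: is_F_def)
    have alg0: "s 0 = 1" "sJ J 0 = 0"
      using assms(7) J by (auto simp: t_algorithm_def)
    have alg: "sJ J q = (\<Sum>p<q. (s p - sJ J p) * F (ms p) (ms q))"
      "ms q \<notin> dominant J \<Longrightarrow> s q = sJ J q" if "q \<in> ?I" "q \<ge> 1" for q
      using assms(7) J that by (auto simp: t_algorithm_def F_def)
    have "has_formal_sum (\<lambda>m m'. lam m * F m m') (?D \<inter> dominant J) chi"
      unfolding has_formal_sum_def
    proof (rule allI)
      fix m'
      let ?S = "{m. m \<in> ?D \<inter> dominant J \<and> lam m * F m m' \<noteq> 0}"
      show "finite ?S \<and> chi m' = (\<Sum>m\<in>?S. lam m * F m m')"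
      proof (cases "m' \<in> ?D")
        case False
        then have "?S = {}" using F_D Dset_trans by fastforce
        then show ?thesis unfolding chi_out[OF False] by (simp only: sum.empty finite.emptyI)
      next
        case True
        then obtain q where q: "q \<in> ?I" "m' = ms q" using img by blast
        have I_le: "{..q} \<subseteq> ?I"
          using q(1) by (auto intro: le_less_trans[of "enat _" "enat q"])
        \<comment> \<open>A contributing monomial lies above \<open>m'\<close>, hence is enumerated
          no later. This gives the finiteness as well.\<close>
        have sub: "?S \<subseteq> ms ` {..q}"
        proof
          fix m assume m: "m \<in> ?S"
          then obtain p where p: "p \<in> ?I" "m = ms p" using img by blast
          have "m' \<in> Dset C r m" using F_D m by fastforce
          from ms_le[OF q(1) p(1)] Dset_mon_le[OF this] have "p \<le> q" by (simp add: q p)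
          then show "m \<in> ms ` {..q}" by (simp add: p)
        qed
        \<comment> \<open>The added terms vanish; for monomials that are not
          \<open>J\<close>-dominant this is the convention that \<open>F\<close> is then 0.\<close>
        have "(\<Sum>m\<in>?S. lam m * F m m') = (\<Sum>m\<in>ms ` {..q}. lam m * F m m')"
          using sub I_le img F_nondom by (intro sum.mono_neutral_left) fastforce+
        also have "\<dots> = (\<Sum>p\<le>q. (s p - sJ J p) * F (ms p) m')"
          using I_le lam
          by (subst sum.reindex[OF inj_on_subset[OF inj I_le]]) (auto intro!: sum.cong)
        also have "\<dots> = (\<Sum>p<q. (s p - sJ J p) * F (ms p) m') + (s q - sJ J q) * F m' m'"
          by (simp add: lessThan_Suc_atMost[symmetric] q(2))
        also have "\<dots> = s q"
        \<comment> \<open>The recursion starts at 1, so position 0 rests on the initial values and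
          on the dominance of \<open>mp\<close>.\<close>
        proof (cases "q = 0")
          case True
          have "m' \<in> dominant J" using assms(4) ms0 q(2) True by (auto simp: dominant_def)
          then show ?thesis using True alg0 F_self by simp
        next
          case False
          then have "(\<Sum>p<q. (s p - sJ J p) * F (ms p) m') = sJ J q"
            using alg(1)[OF q(1)] q(2) by simp
          moreover have "(s q - sJ J q) * F m' m' = s q - sJ J q"
            using False alg(2)[OF q(1)] F_self q(2) by (cases "m' \<in> dominant J") auto
          ultimately show ?thesis by (simp only:) simp
        qed
        finally show ?thesis
          using chi_ms[OF q(1)] q(2) finite_subset[OF sub] by simp
      qed
    qed
    then show ?thesis using assms(5)[OF J] unfolding F_def by blast
  qed
  \<comment> \<open>\<open>K_Jt C r UNIV\<close> is the intersection over single nodes, so the sets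
    \<open>{i}\<close> suffice once they are known to be proper.\<close>
  have single: "{i} \<noteq> UNIV" for i :: 'i
  proof
    assume "{i} = UNIV"
    then have "CARD('i) = card {i}" by simp
    with assms(2) show False by simp
  qed
  have "chi \<in> K_Jt C r UNIV \<inter> Dtilde C r mp"
    using chi_sum[OF insert_not_empty single] unfolding K_Jt_def by simp
  moreover have "supp chi \<inter> dominant UNIV = {mp}"
  proof (intro equalityI subsetI)
    fix m assume m: "m \<in> supp chi \<inter> dominant UNIV"
    then have "m \<in> ?D" using chi_out by (auto simp: supp_def)
    then obtain q where q: "q \<in> ?I" "m = ms q" using img by blast
    \<comment> \<open>The algorithm assigns 0 to every dominant monomial after the first.\<close>
    have "s q = 0" if "q \<ge> 1" using assms(7) q m that by (auto simp: t_algorithm_def)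
    moreover have "s q \<noteq> 0" using m chi_ms[OF q(1)] q(2) by (simp add: supp_def)
    ultimately have "q = 0" by (cases q) auto
    then show "m \<in> {mp}" using ms0 q(2) by simp
  next
    fix m assume "m \<in> {mp}"
    moreover have "chi mp = 1"
      using chi_ms[OF zero] ms0 assms(7) by (simp add: t_algorithm_def)
    ultimately show "m \<in> supp chi \<inter> dominant UNIV" using assms(4) by (simp add: supp_def)
  qed
  ultimately show ?thesis ..
qed

end
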